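(* Let $\Omega\subset\mathbb{R}^m$ be a bounded domain, $\vec F\in L^1(\Omega)$ a vector field, $H\in L^\infty(\Omega)$, and $\mathcal{F}(u)=\int_\Omega\{|\nabla u+\vec F|+Hu\}$. Let $u,\varphi\in W^{1,1}(\Omega)$ and $u_\varepsilon=u+\varepsilon\varphi$ for $\varepsilon\in\mathbb{R}$. Then: (1) $\mathcal{F}(u_\varepsilon)$ is Lipschitz continuous in $\varepsilon$. (2) There are at most countably many singular $\varepsilon$'s. (3) For a regular $\varepsilon$, $\int_{S(u_\varepsilon)}|\nabla\varphi|=0$, the derivative $\frac{d\mathcal{F}(u_\varepsilon)}{d\varepsilon}$ exists, and $$\frac{d\mathcal{F}(u_\varepsilon)}{d\varepsilon}=\int_{\Omega\setminus S(u_\varepsilon)}N(u_\varepsilon)\cdot\nabla\varphi+\int_\Omega H\varphi .$$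
   Context: For $v\in W^{1,1}(\Omega)$, $S(v)=\{\nabla v+\vec F=0\}$ is the singular set of $v$, and $N(v)=\frac{\nabla v+\vec F}{|\nabla v+\vec F|}$ on $\Omega\setminus S(v)$. For fixed $u,\varphi$, let $\kappa(\varepsilon)$ be the Lebesgue measure of $S(u_\varepsilon)\cap\{\nabla\varphi\ne0\}$. The number $\varepsilon$ is called singular if $\kappa(\varepsilon)>0$ and regular if $\kappa(\varepsilon)=0$. *)

theory Defs
  imports "HOL-Analysis.Analysis"
begin

text \<open>Elements of the function spaces are represented by functions on the whole space of which only
  the restriction to \<open>\<Omega>\<close>, up to null sets, is relevant.\<close>

definition L1_on :: "'a::euclidean_space set \<Rightarrow> ('a \<Rightarrow> 'b::{banach, second_countable_topology}) set" where
  "L1_on \<Omega> = {f. integrable (lebesgue_on \<Omega>) f}"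

definition Linfty_on :: "'a::euclidean_space set \<Rightarrow> ('a \<Rightarrow> real) set" where
  "Linfty_on \<Omega> = {f \<in> borel_measurable (lebesgue_on \<Omega>). \<exists>C. AE x in lebesgue_on \<Omega>. \<bar>f x\<bar> \<le> C}"

text \<open>\<open>C\<^sup>k\<close> on the whole space: \<open>frechet_derivative f (at x) b\<close> with \<open>b\<close> in \<open>Basis\<close> is a partial derivative.\<close>

primrec C_k :: "nat \<Rightarrow> ('a::euclidean_space \<Rightarrow> real) \<Rightarrow> bool" where
  "C_k 0 f \<longleftrightarrow> continuous_on UNIV f"
| "C_k (Suc k) f \<longleftrightarrow> (\<forall>x. f differentiable at x) \<and>
     (\<forall>b\<in>Basis. C_k k (\<lambda>x. frechet_derivative f (at x) b))"

definition test_functions :: "'a::euclidean_space set \<Rightarrow> ('a \<Rightarrow> real) set" where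
  "test_functions \<Omega> = {\<psi>. (\<forall>k. C_k k \<psi>) \<and>
     compact (closure {x. \<psi> x \<noteq> 0}) \<and> closure {x. \<psi> x \<noteq> 0} \<subseteq> \<Omega>}"

definition has_weak_gradient ::
    "'a::euclidean_space set \<Rightarrow> ('a \<Rightarrow> real) \<Rightarrow> ('a \<Rightarrow> 'a) \<Rightarrow> bool" where
  "has_weak_gradient \<Omega> u G \<longleftrightarrow> (\<forall>\<psi>\<in>test_functions \<Omega>. \<forall>b\<in>Basis.
     (LINT x|lebesgue_on \<Omega>. u x * frechet_derivative \<psi> (at x) b)
       = - (LINT x|lebesgue_on \<Omega>. (G x \<bullet> b) * \<psi> x))"

definition W11 :: "'a::euclidean_space set \<Rightarrow> ('a \<Rightarrow> real) set" where
  "W11 \<Omega> = {u \<in> L1_on \<Omega>. \<exists>G\<in>L1_on \<Omega>. has_weak_gradient \<Omega> u G}"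

text \<open>A representative of the weak gradient; for \<open>u\<close> in \<open>W11 \<Omega>\<close> with \<open>\<Omega>\<close> open, it is unique up to
  null subsets of \<open>\<Omega>\<close>, and everything below depends only on this equivalence class (the singular
  set itself up to null sets).\<close>

definition wgrad :: "'a::euclidean_space set \<Rightarrow> ('a \<Rightarrow> real) \<Rightarrow> 'a \<Rightarrow> 'a" where
  "wgrad \<Omega> u = (SOME G. G \<in> L1_on \<Omega> \<and> has_weak_gradient \<Omega> u G)"

definition functional ::
    "'a::euclidean_space set \<Rightarrow> ('a \<Rightarrow> 'a) \<Rightarrow> ('a \<Rightarrow> real) \<Rightarrow> ('a \<Rightarrow> real) \<Rightarrow> real" where
  "functional \<Omega> F H u = (LINT x|lebesgue_on \<Omega>. norm (wgrad \<Omega> u x + F x) + H x * u x)"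

definition sing_set ::
    "'a::euclidean_space set \<Rightarrow> ('a \<Rightarrow> 'a) \<Rightarrow> ('a \<Rightarrow> real) \<Rightarrow> 'a set" where
  "sing_set \<Omega> F v = {x \<in> \<Omega>. wgrad \<Omega> v x + F x = 0}"

text \<open>Only meaningful off the singular set, where the denominator is nonzero.\<close>

definition N_field ::
    "'a::euclidean_space set \<Rightarrow> ('a \<Rightarrow> 'a) \<Rightarrow> ('a \<Rightarrow> real) \<Rightarrow> 'a \<Rightarrow> 'a" where
  "N_field \<Omega> F v x = (wgrad \<Omega> v x + F x) /\<^sub>R norm (wgrad \<Omega> v x + F x)"

definition perturb :: "('a \<Rightarrow> real) \<Rightarrow> ('a \<Rightarrow> real) \<Rightarrow> real \<Rightarrow> 'a \<Rightarrow> real" where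
  "perturb u \<phi> \<epsilon> = (\<lambda>x. u x + \<epsilon> * \<phi> x)"

definition kappa :: "'a::euclidean_space set \<Rightarrow> ('a \<Rightarrow> 'a) \<Rightarrow> ('a \<Rightarrow> real) \<Rightarrow> ('a \<Rightarrow> real) \<Rightarrow> real \<Rightarrow> ennreal" where
  "kappa \<Omega> F u \<phi> \<epsilon> =
     emeasure lebesgue (sing_set \<Omega> F (perturb u \<phi> \<epsilon>) \<inter> {x \<in> \<Omega>. wgrad \<Omega> \<phi> x \<noteq> 0})"

definition singular_eps ::
    "'a::euclidean_space set \<Rightarrow> ('a \<Rightarrow> 'a) \<Rightarrow> ('a \<Rightarrow> real) \<Rightarrow> ('a \<Rightarrow> real) \<Rightarrow> real \<Rightarrow> bool" where
  "singular_eps \<Omega> F u \<phi> \<epsilon> \<longleftrightarrow> kappa \<Omega> F u \<phi> \<epsilon> > 0"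

definition regular_eps ::
    "'a::euclidean_space set \<Rightarrow> ('a \<Rightarrow> 'a) \<Rightarrow> ('a \<Rightarrow> real) \<Rightarrow> ('a \<Rightarrow> real) \<Rightarrow> real \<Rightarrow> bool" where
  "regular_eps \<Omega> F u \<phi> \<epsilon> \<longleftrightarrow> kappa \<Omega> F u \<phi> \<epsilon> = 0"

end

theory Submission
  imports Defs
begin

text \<open>Uniqueness of weak gradients makes the chosen gradient of \<open>u + \<epsilon> \<phi>\<close> equal to
  \<open>\<nabla>u + \<epsilon> \<nabla>\<phi>\<close> almost everywhere, so the functional is, up to an affine function of \<open>\<epsilon>\<close>,
  the integral of \<open>\<bar>a + \<epsilon> p\<bar>\<close> with \<open>a = \<nabla>u + F\<close> and \<open>p = \<nabla>\<phi>\<close>. The integrand is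
  Lipschitz in \<open>\<epsilon>\<close> with the integrable constant \<open>\<bar>p\<bar>\<close>, which gives (1) and dominates the difference
  quotients in (3); these converge wherever \<open>a + \<epsilon> p \<noteq> 0\<close> or \<open>p = 0\<close>. Finally, the sets
  \<open>{a + \<epsilon> p = 0, p \<noteq> 0}\<close> are disjoint for distinct \<open>\<epsilon>\<close>, and only countably many of them can
  have positive measure.\<close>

subsection \<open>Smooth bump functions on boxes\<close>

text \<open>For \<open>j = 0\<close> this is the classical smooth function that is flat at 0.
  Differentiation produces powers of \<open>1 / t\<close>, so they are carried along as a parameter:
  the derivative of each member is a linear combination of two others.\<close>

definition flat_exp :: "nat \<Rightarrow> real \<Rightarrow> real" where
  "flat_exp j t = (if t > 0 then exp (- 1 / t) / t ^ j else 0)"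

text \<open>From the right, \<open>s = 1 / t\<close> turns the claim into the decay of
  \<open>s ^ j / exp s\<close> at infinity; from the left the function is constantly 0.\<close>

lemma flat_exp_tendsto_0: "(flat_exp j \<longlongrightarrow> 0) (at 0)"
proof -
  have "((\<lambda>s. s ^ j / exp s) \<longlongrightarrow> (0::real)) at_top"
    by (rule tendsto_power_div_exp_0)
  then have "((\<lambda>t. inverse t ^ j / exp (inverse t)) \<longlongrightarrow> (0::real)) (at_right 0)"
    using filterlim_inverse_at_top_right by (rule filterlim_compose)
  moreover have "\<forall>\<^sub>F t in at_right 0. inverse t ^ j / exp (inverse t) = flat_exp j t"
    by (auto simp: eventually_at_filter flat_exp_def field_simps exp_minus)
  ultimately have r: "(flat_exp j \<longlongrightarrow> 0) (at_right 0)"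
    using tendsto_cong by fast
  have "\<forall>\<^sub>F t in at_left 0. 0 = flat_exp j t"
    by (auto simp: eventually_at_filter flat_exp_def)
  then have "(flat_exp j \<longlongrightarrow> 0) (at_left 0)"
    by (rule Lim_transform_eventually[rotated]) simp
  with r show ?thesis by (simp add: filterlim_split_at)
qed

lemma flat_exp_has_real_derivative:
  "(flat_exp j has_real_derivative flat_exp (j + 2) t - real j * flat_exp (j + 1) t) (at t)"
proof (cases t "0::real" rule: linorder_cases)
  case less
  have "((\<lambda>_. 0) has_real_derivative flat_exp (j + 2) t - real j * flat_exp (j + 1) t) (at t)"
    using less by (simp add: flat_exp_def)
  then show ?thesis
    by (rule has_field_derivative_transform_within_open[where S = "{..<0}"])
      (use less in \<open>auto simp: flat_exp_def\<close>)
next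
  case equal
  \<comment> \<open>Dividing by \<open>h\<close> merely raises the index, so the difference quotient
    at 0 is another member of the family and tends to 0. The claimed derivative is 0 there as
    well.\<close>
  have "\<forall>\<^sub>F h in at 0. flat_exp (j + 1) h = (flat_exp j (0 + h) - flat_exp j 0) / h"
    by (auto simp: eventually_at_filter flat_exp_def field_simps)
  then have "((\<lambda>h. (flat_exp j (0 + h) - flat_exp j 0) / h) \<longlongrightarrow> 0) (at 0)"
    using flat_exp_tendsto_0 by (rule Lim_transform_eventually[rotated])
  then show ?thesis
    using equal by (simp add: DERIV_def flat_exp_def)
next
  case greater
  have "((\<lambda>t. exp (- 1 / t) / t ^ j) has_real_derivative
      (exp (- 1 / t) / t\<^sup>2 * t ^ j - exp (- 1 / t) * (real j * t ^ (j - 1))) / (t ^ j * t ^ j)) (at t)"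
    using greater by (auto intro!: derivative_eq_intros simp: power2_eq_square)
  \<comment> \<open>For \<open>j = 0\<close> the truncated exponent \<open>j - 1\<close> does no
    harm, because the factor \<open>real j\<close> makes both sides 0.\<close>
  also have "real j * t ^ (j - 1) = real j * t ^ j / t"
    using greater by (cases j) auto
  also have "(exp (- 1 / t) / t\<^sup>2 * t ^ j - exp (- 1 / t) * (real j * t ^ j / t)) / (t ^ j * t ^ j)
      = flat_exp (j + 2) t - real j * flat_exp (j + 1) t"
    using greater by (simp add: flat_exp_def field_simps power2_eq_square)
  finally have "((\<lambda>t. exp (- 1 / t) / t ^ j) has_real_derivative
      flat_exp (j + 2) t - real j * flat_exp (j + 1) t) (at t)" .
  then show ?thesis
    by (rule has_field_derivative_transform_within_open[where S = "{0<..}"])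
      (use greater in \<open>auto simp: flat_exp_def\<close>)
qed

text \<open>This algebra contains the bumps below and is closed under partial derivatives, which gives
  \<open>C_k\<close> for all \<open>k\<close> without computing any higher derivative.\<close>

inductive flat_alg :: "('a::euclidean_space \<Rightarrow> real) \<Rightarrow> bool" where
  const: "flat_alg (\<lambda>_. c)"
| flat_exp: "flat_alg (\<lambda>x. flat_exp j (v \<bullet> x + c))"
| add: "flat_alg f \<Longrightarrow> flat_alg g \<Longrightarrow> flat_alg (\<lambda>x. f x + g x)"
| mult: "flat_alg f \<Longrightarrow> flat_alg g \<Longrightarrow> flat_alg (\<lambda>x. f x * g x)"

text \<open>Structural induction: the chain rule shifts the index of a generator, the Leibniz rule
  stays within sums and products. A single \<open>D\<close> carries both the derivative and the
  closure property, so that the result can be iterated.\<close>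

lemma flat_alg_derivative:
  assumes "flat_alg f"
  shows "\<exists>D. (\<forall>x. (f has_derivative D x) (at x)) \<and> (\<forall>b. flat_alg (\<lambda>x. D x b))"
  using assms
proof induction
  case (const c)
  show ?case
    by (rule exI[of _ "\<lambda>_ _. 0"]) (auto intro: flat_alg.const)
next
  case (flat_exp j v c)
  \<comment> \<open>The difference is written as a sum with the constant factor
    \<open>- real j\<close>, since the algebra is generated by constants, sums and products.\<close>
  let ?D = "\<lambda>x h. (flat_exp (j + 2) (v \<bullet> x + c) + (- real j) * flat_exp (j + 1) (v \<bullet> x + c)) * (v \<bullet> h)"
  have "((\<lambda>x. flat_exp j (v \<bullet> x + c)) has_derivative ?D x) (at x)" for x
  proof -
    have "((\<lambda>x. v \<bullet> x + c) has_derivative (\<lambda>h. v \<bullet> h)) (at x)"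
      by (auto intro!: derivative_eq_intros)
    from has_derivative_compose[OF this flat_exp_has_real_derivative[unfolded has_field_derivative_def]]
    show ?thesis by simp
  qed
  moreover have "flat_alg (\<lambda>x. ?D x b)" for b
    by (intro flat_alg.intros)
  ultimately show ?case by (intro exI[of _ ?D] conjI allI)
next
  case (add f g)
  then obtain D E where "\<And>x. (f has_derivative D x) (at x)" "\<And>b. flat_alg (\<lambda>x. D x b)"
    "\<And>x. (g has_derivative E x) (at x)" "\<And>b. flat_alg (\<lambda>x. E x b)" by blast
  then show ?case
    by (intro exI[of _ "\<lambda>x h. D x h + E x h"]) (auto intro: flat_alg.intros has_derivative_add)
next
  case (mult f g)
  then obtain D E where "\<And>x. (f has_derivative D x) (at x)" "\<And>b. flat_alg (\<lambda>x. D x b)"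
    "\<And>x. (g has_derivative E x) (at x)" "\<And>b. flat_alg (\<lambda>x. E x b)" by blast
  with mult show ?case
    by (intro exI[of _ "\<lambda>x h. f x * E x h + D x h * g x"])
      (auto intro!: flat_alg.intros has_derivative_mult)
qed

lemma flat_alg_C_k: "flat_alg f \<Longrightarrow> C_k k f"
proof (induction k arbitrary: f)
  case 0
  then obtain D where "\<And>x. (f has_derivative D x) (at x)"
    using flat_alg_derivative by blast
  then show ?case
    by (auto intro!: continuous_at_imp_continuous_on has_derivative_continuous)
next
  case (Suc k)
  obtain D where D: "\<And>x. (f has_derivative D x) (at x)" "\<And>b. flat_alg (\<lambda>x. D x b)"
    using flat_alg_derivative[OF Suc.prems] by blast
  then have "frechet_derivative f (at x) = D x" for x
    using frechet_derivative_at by metis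
  with D Suc.IH show ?case
    by (auto simp: differentiable_def)
qed

lemma flat_alg_prod: "(\<And>i. i \<in> I \<Longrightarrow> flat_alg (f i)) \<Longrightarrow> flat_alg (\<lambda>x. \<Prod>i\<in>I. f i x)"
  by (induction I rule: infinite_finite_induct) (auto intro: flat_alg.const flat_alg.mult)

text \<open>Since \<open>flat_exp 0 (n t) = (exp (- 1 / t)) powr (1 / n)\<close> for \<open>t > 0\<close>, these increase to the
  indicator of the open box while keeping their support.\<close>

definition box_bump :: "nat \<Rightarrow> 'a::euclidean_space \<Rightarrow> 'a \<Rightarrow> 'a \<Rightarrow> real" where
  "box_bump n a b x = (\<Prod>i\<in>Basis.
     flat_exp 0 (real n * (x \<bullet> i - a \<bullet> i)) * flat_exp 0 (real n * (b \<bullet> i - x \<bullet> i)))"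

lemma box_bump_flat_alg: "flat_alg (box_bump n a b)"
proof -
  have "flat_alg (\<lambda>x. \<Prod>i\<in>Basis. flat_exp 0 ((real n *\<^sub>R i) \<bullet> x + (- real n * (a \<bullet> i)))
      * flat_exp 0 ((- real n *\<^sub>R i) \<bullet> x + real n * (b \<bullet> i)))"
    by (intro flat_alg_prod flat_alg.mult flat_alg.flat_exp)
  also have "(\<lambda>x. \<Prod>i\<in>Basis. flat_exp 0 ((real n *\<^sub>R i) \<bullet> x + (- real n * (a \<bullet> i)))
      * flat_exp 0 ((- real n *\<^sub>R i) \<bullet> x + real n * (b \<bullet> i))) = box_bump n a b"
    by (auto simp: box_bump_def fun_eq_iff algebra_simps inner_commute intro!: prod.cong)
  finally show ?thesis .
qed

lemma box_bump_eq_0: "x \<notin> box a b \<Longrightarrow> box_bump n a b x = 0"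
  by (auto simp: box_bump_def mem_box flat_exp_def zero_less_mult_iff)

text \<open>The hypothesis concerns the closed box because the support is a closure and may reach
  the boundary of the open one.\<close>

lemma box_bump_test_function:
  assumes "cbox a b \<subseteq> \<Omega>"
  shows "box_bump n a b \<in> test_functions \<Omega>"
proof -
  have "{x. box_bump n a b x \<noteq> 0} \<subseteq> cbox a b"
    using box_bump_eq_0 box_subset_cbox by blast
  then have s: "closure {x. box_bump n a b x \<noteq> 0} \<subseteq> cbox a b"
    by (rule closure_minimal) (rule closed_cbox)
  then have "compact (closure {x. box_bump n a b x \<noteq> 0})"
    using bounded_subset[OF bounded_cbox] by (auto simp: compact_eq_bounded_closed)
  with s assms show ?thesis
    by (auto simp: test_functions_def intro: flat_alg_C_k box_bump_flat_alg)
qed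

lemma box_bump_bounds: "0 \<le> box_bump n a b x" "box_bump n a b x \<le> 1"
proof -
  have f: "0 \<le> flat_exp 0 t" "flat_exp 0 t \<le> 1" for t
    by (auto simp: flat_exp_def)
  show "0 \<le> box_bump n a b x"
    unfolding box_bump_def by (intro prod_nonneg ballI mult_nonneg_nonneg f)
  show "box_bump n a b x \<le> 1"
    unfolding box_bump_def by (intro prod_le_1 conjI mult_nonneg_nonneg mult_le_one f)
qed

lemma box_bump_tendsto: "(\<lambda>n. box_bump n a b x) \<longlonglongrightarrow> indicator (box a b) x"
proof (cases "x \<in> box a b")
  case True
  have f: "(\<lambda>n. flat_exp 0 (real n * t)) \<longlonglongrightarrow> 1" if "t > 0" for t
  proof (rule Lim_transform_eventually)
    have "(\<lambda>n. - (1 / t) * (1 / real n)) \<longlonglongrightarrow> - (1 / t) * 0"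
      by (intro tendsto_mult tendsto_const lim_1_over_n)
    then have "(\<lambda>n. exp (- (1 / t) * (1 / real n))) \<longlonglongrightarrow> exp (- (1 / t) * 0)"
      by (rule tendsto_exp)
    then show "(\<lambda>n. exp (- (1 / t) * (1 / real n))) \<longlonglongrightarrow> 1" by simp
    \<comment> \<open>At \<open>n = 0\<close> the sides differ: the left one is
      \<open>exp 0 = 1\<close> by the convention \<open>1 / 0 = 0\<close>, the right one is
      \<open>flat_exp 0 0 = 0\<close>.\<close>
    show "\<forall>\<^sub>F n in sequentially. exp (- (1 / t) * (1 / real n)) = flat_exp 0 (real n * t)"
      using eventually_gt_at_top[of 0] by eventually_elim (use that in \<open>auto simp: flat_exp_def field_simps\<close>)
  qed
  have "(\<lambda>n. box_bump n a b x) \<longlonglongrightarrow> (\<Prod>i\<in>(Basis::'a set). 1 * 1)"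
    unfolding box_bump_def using True by (intro tendsto_prod tendsto_mult f) (auto simp: mem_box)
  with True show ?thesis by simp
qed (simp add: box_bump_eq_0)

subsection \<open>Test functions and weak gradients\<close>

lemma continuous_zero_outside_compact_bounded:
  fixes f :: "'a::euclidean_space \<Rightarrow> real"
  assumes "continuous_on UNIV f" "compact K" "\<And>x. x \<notin> K \<Longrightarrow> f x = 0"
  obtains B where "\<And>x. \<bar>f x\<bar> \<le> B"
proof -
  have "bounded (f ` K)"
    using assms continuous_on_subset by (blast intro: compact_imp_bounded compact_continuous_image)
  then obtain B where "\<And>x. x \<in> K \<Longrightarrow> \<bar>f x\<bar> \<le> B"
    by (auto simp: bounded_iff)
  then have "\<bar>f x\<bar> \<le> max B 0" for x
    using assms(3) by (cases "x \<in> K") (auto simp: le_max_iff_disj)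
  then show thesis by (rule that)
qed

lemma test_function_regularity:
  assumes "\<psi> \<in> test_functions \<Omega>" "b \<in> Basis"
  shows "continuous_on UNIV \<psi>" "continuous_on UNIV (\<lambda>x. frechet_derivative \<psi> (at x) b)"
    "\<exists>B. \<forall>x. \<bar>\<psi> x\<bar> \<le> B" "\<exists>B. \<forall>x. \<bar>frechet_derivative \<psi> (at x) b\<bar> \<le> B"
proof -
  define K where "K = closure {x. \<psi> x \<noteq> 0}"
  have C: "C_k k \<psi>" for k
    using assms by (auto simp: test_functions_def)
  have K: "compact K"
    using assms by (auto simp: test_functions_def K_def)
  show c: "continuous_on UNIV \<psi>"
    using C[of 0] by simp
  show d: "continuous_on UNIV (\<lambda>x. frechet_derivative \<psi> (at x) b)"
    using C[of "Suc 0"] assms(2) unfolding C_k.simps by blast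
  have z: "\<psi> x = 0" if "x \<notin> K" for x
    using that closure_subset[of "{x. \<psi> x \<noteq> 0}"] unfolding K_def by blast
  \<comment> \<open>The complement of the support is open and \<psi> vanishes on it, so the
    derivative vanishes there too.\<close>
  have z': "frechet_derivative \<psi> (at x) b = 0" if "x \<notin> K" for x
  proof -
    have "((\<lambda>_. 0) has_derivative (\<lambda>_. 0)) (at x)" by simp
    then have "(\<psi> has_derivative (\<lambda>_. 0)) (at x)"
      by (rule has_derivative_transform_within_open[where s = "- K"]) (use that z K in \<open>auto simp: compact_imp_closed\<close>)
    then show ?thesis
      using frechet_derivative_at by metis
  qed
  show "\<exists>B. \<forall>x. \<bar>\<psi> x\<bar> \<le> B"
    by (rule continuous_zero_outside_compact_bounded[OF c K z]) blast+
  show "\<exists>B. \<forall>x. \<bar>frechet_derivative \<psi> (at x) b\<bar> \<le> B"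
    by (rule continuous_zero_outside_compact_bounded[OF d K z']) blast+
qed

lemma integrable_mult_bounded:
  fixes f g :: "'a \<Rightarrow> real"
  assumes "integrable M f" "g \<in> borel_measurable M" "AE x in M. \<bar>g x\<bar> \<le> B"
  shows "integrable M (\<lambda>x. g x * f x)"
proof (rule Bochner_Integration.integrable_bound)
  show "integrable M (\<lambda>x. B * f x)" using assms by simp
  show "(\<lambda>x. g x * f x) \<in> borel_measurable M" using assms by measurable
  show "AE x in M. norm (g x * f x) \<le> norm (B * f x)"
    using assms(3) by eventually_elim (force simp: abs_mult intro: mult_right_mono)
qed

lemma continuous_on_measurable_lebesgue_on:
  fixes f :: "'a::euclidean_space \<Rightarrow> real"
  shows "continuous_on UNIV f \<Longrightarrow> f \<in> borel_measurable (lebesgue_on S)"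
  by (intro measurable_restrict_space1 measurable_completion) (simp add: borel_measurable_continuous_onI)

text \<open>A non-integrable function has integral 0 by convention, so splitting the integrals in
  \<open>has_weak_gradient\<close> requires these facts; they hold because \<psi> and its partial
  derivatives are continuous and bounded.\<close>

lemma integrable_mult_test:
  assumes "integrable (lebesgue_on \<Omega>) f" "\<psi> \<in> test_functions \<Omega>" "b \<in> Basis"
  shows "integrable (lebesgue_on \<Omega>) (\<lambda>x. f x * \<psi> x)"
    "integrable (lebesgue_on \<Omega>) (\<lambda>x. f x * frechet_derivative \<psi> (at x) b)"
proof -
  note r = test_function_regularity[OF assms(2,3)]
  obtain B B' where B: "\<And>x. \<bar>\<psi> x\<bar> \<le> B" "\<And>x. \<bar>frechet_derivative \<psi> (at x) b\<bar> \<le> B'"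
    using r(3,4) by blast
  have "integrable (lebesgue_on \<Omega>) (\<lambda>x. \<psi> x * f x)"
    "integrable (lebesgue_on \<Omega>) (\<lambda>x. frechet_derivative \<psi> (at x) b * f x)"
    by (rule integrable_mult_bounded[OF assms(1)] continuous_on_measurable_lebesgue_on r(1,2) AE_I2 B)+
  then show "integrable (lebesgue_on \<Omega>) (\<lambda>x. f x * \<psi> x)"
    "integrable (lebesgue_on \<Omega>) (\<lambda>x. f x * frechet_derivative \<psi> (at x) b)"
    by (simp_all add: mult.commute)
qed

lemma has_weak_gradient_add_scaled:
  assumes "u \<in> L1_on \<Omega>" "v \<in> L1_on \<Omega>" "G \<in> L1_on \<Omega>" "K \<in> L1_on \<Omega>"
    and "has_weak_gradient \<Omega> u G" "has_weak_gradient \<Omega> v K"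
  shows "has_weak_gradient \<Omega> (\<lambda>x. u x + c * v x) (\<lambda>x. G x + c *\<^sub>R K x)"
  unfolding has_weak_gradient_def
proof (intro ballI)
  fix \<psi> and b :: 'a
  assume \<psi>: "\<psi> \<in> test_functions \<Omega>" and b: "b \<in> Basis"
  let ?M = "lebesgue_on \<Omega>" and ?d = "\<lambda>x. frechet_derivative \<psi> (at x) b"
  have i: "integrable ?M u" "integrable ?M v" "integrable ?M (\<lambda>x. G x \<bullet> b)" "integrable ?M (\<lambda>x. K x \<bullet> b)"
    using assms(1-4) by (auto simp: L1_on_def)
  note [simp] = integrable_mult_test(1)[OF i(3) \<psi> b] integrable_mult_test(1)[OF i(4) \<psi> b]
    integrable_mult_test(2)[OF i(1) \<psi> b] integrable_mult_test(2)[OF i(2) \<psi> b]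
  have "(LINT x|?M. (u x + c * v x) * ?d x) = (LINT x|?M. u x * ?d x + c * (v x * ?d x))"
    by (simp add: algebra_simps)
  also have "\<dots> = (LINT x|?M. u x * ?d x) + c * (LINT x|?M. v x * ?d x)"
    by (subst Bochner_Integration.integral_add) auto
  also have "\<dots> = - ((LINT x|?M. (G x \<bullet> b) * \<psi> x) + c * (LINT x|?M. (K x \<bullet> b) * \<psi> x))"
    using assms(5,6) \<psi> b by (simp add: has_weak_gradient_def)
  also have "\<dots> = - (LINT x|?M. (G x \<bullet> b) * \<psi> x + c * ((K x \<bullet> b) * \<psi> x))"
    by (subst Bochner_Integration.integral_add) auto
  also have "\<dots> = - (LINT x|?M. ((G x + c *\<^sub>R K x) \<bullet> b) * \<psi> x)"
    by (simp add: algebra_simps inner_add_left)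
  finally show "(LINT x|?M. (u x + c * v x) * ?d x) = - (LINT x|?M. ((G x + c *\<^sub>R K x) \<bullet> b) * \<psi> x)" .
qed

subsection \<open>Uniqueness of the weak gradient\<close>

text \<open>Boxes are an intersection-stable generator of the Borel sets, and the sets over which
  the truncation of \<open>f\<close> to \<open>box c d\<close> integrates to 0 form a Dynkin system.
  Complements work because the total integral of the truncation is the integral over
  \<open>box c d\<close> itself. A function whose integral over every Borel set is 0 vanishes almost
  everywhere.\<close>

lemma AE_zero_from_box_integrals:
  fixes f :: "'a::euclidean_space \<Rightarrow> real"
  assumes f: "integrable lborel f"
    and zero: "\<And>a b. box a b \<subseteq> box c d \<Longrightarrow> (LINT x:box a b|lborel. f x) = 0"
  shows "AE x in lborel. x \<in> box c d \<longrightarrow> f x = 0"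
proof -
  let ?g = "\<lambda>x. indicator (box c d) x * f x"
  have g: "integrable lborel ?g"
    using integrable_mult_indicator[OF _ f, of "box c d"] by simp
  have gA: "set_integrable lborel A ?g" if "A \<in> sets borel" for A
    using integrable_mult_indicator[OF _ g, of A] that by (simp add: set_integrable_def)
  have "(LINT x:A|lborel. ?g x) = 0" if "A \<in> sets borel" for A
  proof -
    let ?E = "range (\<lambda>(a, b). box a b :: 'a set)"
    have E: "Int_stable ?E" "?E \<subseteq> Pow UNIV"
      by (auto simp: Int_stable_def box_Int_box)
    have S: "sets borel = sigma_sets UNIV ?E"
      by (simp add: borel_eq_box)
    have box0: "(LINT x:box a b|lborel. ?g x) = 0" for a b
    proof -
      obtain a' b' where ab: "box a b \<inter> box c d = box a' b'"
        by (rule that[OF box_Int_box])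
      have "(LINT x:box a b|lborel. ?g x) = (LINT x:box a b \<inter> box c d|lborel. f x)"
        by (simp add: set_lebesgue_integral_def indicator_inter_arith mult.assoc)
      then show ?thesis using zero[of a' b'] ab by auto
    qed
    show ?thesis
      using E that[unfolded S]
    proof (induction rule: sigma_sets_induct_disjoint)
      case (basic A)
      then show ?case using box0 by auto
    next
      case empty
      show ?case by (simp add: set_lebesgue_integral_def)
    next
      case (compl A)
      then have A: "A \<in> sets borel" by (simp add: S)
      have "(LINT x:A|lborel. ?g x) + (LINT x:UNIV - A|lborel. ?g x) = (LINT x:A \<union> (UNIV - A)|lborel. ?g x)"
        by (rule set_integral_Un[symmetric]) (use A in \<open>auto intro!: gA\<close>)
      also have "\<dots> = (LINT x:box c d|lborel. ?g x)"
        by (simp add: set_lebesgue_integral_def mult.assoc[symmetric] indicator_inter_arith[symmetric])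
      finally show ?case using compl box0 by simp
    next
      case (union A)
      then have A: "A i \<in> sets borel" for i by (auto simp: S)
      have "(LINT x:(\<Union>i. A i)|lborel. ?g x) = (\<Sum>i. (LINT x:A i|lborel. ?g x))"
        using A union(1) by (intro lebesgue_integral_countable_add gA) (auto simp: disjoint_family_on_def)
      with union show ?case by simp
    qed
  qed
  then have "AE x in lborel. ?g x = 0"
    by (intro sigma_finite_measure.density_zero[OF sigma_finite_lborel] g) auto
  then show ?thesis by eventually_elim auto
qed

text \<open>The bumps on a box lie between 0 and 1 and converge to its indicator, so by dominated
  convergence the integral over every box with closed box inside \<Omega> is 0. Hence
  \<open>f\<close> vanishes almost everywhere on each such box, and countably many of them cover
  \<Omega>.\<close>

lemma fundamental_lemma_calculus_of_variations:
  fixes f :: "'a::euclidean_space \<Rightarrow> real"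
  assumes "open \<Omega>" and f: "integrable (lebesgue_on \<Omega>) f"
    and zero: "\<And>\<psi>. \<psi> \<in> test_functions \<Omega> \<Longrightarrow> (LINT x|lebesgue_on \<Omega>. f x * \<psi> x) = 0"
  shows "AE x in lebesgue_on \<Omega>. f x = 0"
proof -
  have \<Omega>: "\<Omega> \<inter> space lebesgue \<in> sets lebesgue"
    using \<open>open \<Omega>\<close> by simp
  define g where "g = (\<lambda>x. indicator \<Omega> x * f x)"
  have g: "integrable lebesgue g"
    using f integrable_restrict_space[OF \<Omega>, of f] by (simp add: g_def)
  \<comment> \<open>The extension \<open>g\<close> by zero is only Lebesgue measurable; a Borel
    representative makes the box argument over \<open>lborel\<close> applicable.\<close>
  then obtain h where h: "h \<in> borel_measurable lborel" and gh: "AE x in lborel. g x = h x"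
    using completion_ex_borel_measurable_real by (metis borel_measurable_integrable)
  have gh': "AE x in lebesgue. g x = h x"
    using gh by (rule AE_completion)
  have hm: "h \<in> borel_measurable lebesgue"
    using h by (rule measurable_completion)
  have "integrable lebesgue h"
    using g gh' hm integrable_cong_AE[of g lebesgue h] by blast
  then have hi: "integrable lborel h"
    using h integrable_completion by blast
  have box0: "(LINT x:box a b|lborel. h x) = 0" if ab: "cbox a b \<subseteq> \<Omega>" for a b
  proof -
    have bm: "(\<lambda>x. box_bump n a b x) \<in> borel_measurable lborel" for n
      using flat_alg_C_k[OF box_bump_flat_alg, of 0 n a b]
      by (simp add: borel_measurable_continuous_onI)
    have "(LINT x|lborel. h x * box_bump n a b x) = 0" for n
    proof -
      have "(LINT x|lborel. h x * box_bump n a b x) = (LINT x|lebesgue. h x * box_bump n a b x)"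
        by (intro integral_completion[symmetric] borel_measurable_times h bm)
      also have "\<dots> = (LINT x|lebesgue. g x * box_bump n a b x)"
      proof (rule integral_cong_AE)
        show "(\<lambda>x. h x * box_bump n a b x) \<in> borel_measurable lebesgue"
          by (intro borel_measurable_times hm measurable_completion bm)
        show "(\<lambda>x. g x * box_bump n a b x) \<in> borel_measurable lebesgue"
          by (intro borel_measurable_times borel_measurable_integrable[OF g] measurable_completion bm)
        show "AE x in lebesgue. h x * box_bump n a b x = g x * box_bump n a b x"
          using gh' by eventually_elim simp
      qed
      also have "\<dots> = (LINT x|lebesgue_on \<Omega>. f x * box_bump n a b x)"
        using integral_restrict_space[OF \<Omega>, of "\<lambda>x. f x * box_bump n a b x"]
        by (simp add: g_def mult.assoc)
      also have "\<dots> = 0"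
        by (intro zero box_bump_test_function ab)
      finally show ?thesis .
    qed
    moreover have "(\<lambda>n. LINT x|lborel. h x * box_bump n a b x) \<longlonglongrightarrow> (LINT x|lborel. h x * indicator (box a b) x)"
    proof (rule integral_dominated_convergence)
      show "integrable lborel (\<lambda>x. \<bar>h x\<bar>)" using hi by simp
      show "AE x in lborel. norm (h x * box_bump n a b x) \<le> \<bar>h x\<bar>" for n
        using box_bump_bounds[of n a b] by (intro AE_I2) (simp add: abs_mult mult_left_le)
    qed (use h bm in \<open>auto intro!: tendsto_mult box_bump_tendsto\<close>)
    ultimately show ?thesis
      by (simp add: set_lebesgue_integral_def mult.commute LIMSEQ_const_iff)
  qed
  let ?F = "{box a b |a b. cbox a b \<subseteq> \<Omega>}"
  \<comment> \<open>Lindelof reduces the cover to a countable one, so that the exceptional null sets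
    unite to a null set.\<close>
  have "open B" if "B \<in> ?F" for B
    using that by (auto simp: open_box)
  then obtain \<D> where \<D>: "\<D> \<subseteq> ?F" "countable \<D>" "\<Union>\<D> = \<Union>?F"
    by (rule Lindelof)
  have cover: "\<Omega> \<subseteq> \<Union>?F"
  proof
    fix x assume "x \<in> \<Omega>"
    then obtain a b where "cbox a b \<subseteq> \<Omega>" "x \<in> box a b"
      using open_contains_cbox[OF \<open>open \<Omega>\<close>] by metis
    then show "x \<in> \<Union>?F" by blast
  qed
  have "AE x in lborel. \<forall>B\<in>\<D>. x \<in> B \<longrightarrow> h x = 0"
  proof (rule AE_ball_countable')
    fix B assume "B \<in> \<D>"
    then obtain c d where B: "B = box c d" and cd: "cbox c d \<subseteq> \<Omega>" using \<D>(1) by blast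
    \<comment> \<open>Only for a nonempty open box is \<open>cbox a b\<close> its closure and hence
      inside \<Omega>. For an empty one, \<open>cbox a b\<close> can be a degenerate box lying
      elsewhere, but the integral is trivially 0.\<close>
    have "(LINT x:box a b|lborel. h x) = 0" if "box a b \<subseteq> box c d" for a b
    proof (cases "box a b = {}")
      case True
      then show ?thesis by (simp add: set_lebesgue_integral_def)
    next
      case False
      then have "cbox a b \<subseteq> \<Omega>"
        using closure_mono[OF that] closure_minimal[OF box_subset_cbox[of c d] closed_cbox] cd
        by (simp add: closure_box)
      then show ?thesis by (rule box0)
    qed
    then show "AE x in lborel. x \<in> B \<longrightarrow> h x = 0"
      unfolding B by (rule AE_zero_from_box_integrals[OF hi])
  qed (rule \<D>)
  then have "AE x in lborel. x \<in> \<Omega> \<longrightarrow> f x = 0"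
    using gh by eventually_elim (use \<D>(3) cover in \<open>auto simp: g_def\<close>)
  then show ?thesis
    by (simp add: AE_restrict_space_iff[OF \<Omega>] AE_completion)
qed

text \<open>The fundamental lemma applies to each coordinate of the difference, and there are
  finitely many coordinates.\<close>

lemma weak_gradient_unique:
  assumes "open \<Omega>" "G \<in> L1_on \<Omega>" "K \<in> L1_on \<Omega>"
    and "has_weak_gradient \<Omega> u G" "has_weak_gradient \<Omega> u K"
  shows "AE x in lebesgue_on \<Omega>. G x = K x"
proof -
  let ?M = "lebesgue_on \<Omega>"
  have "AE x in ?M. (G x - K x) \<bullet> b = 0" if b: "b \<in> Basis" for b
  proof (rule fundamental_lemma_calculus_of_variations[OF \<open>open \<Omega>\<close>])
    have i: "integrable ?M (\<lambda>x. G x \<bullet> b)" "integrable ?M (\<lambda>x. K x \<bullet> b)"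
      using assms(2,3) by (auto simp: L1_on_def)
    then show "integrable ?M (\<lambda>x. (G x - K x) \<bullet> b)"
      by (simp add: inner_diff_left)
    fix \<psi> assume \<psi>: "\<psi> \<in> test_functions \<Omega>"
    have "(LINT x|?M. (G x - K x) \<bullet> b * \<psi> x) = (LINT x|?M. G x \<bullet> b * \<psi> x) - (LINT x|?M. K x \<bullet> b * \<psi> x)"
      using integrable_mult_test(1)[OF i(1) \<psi> b] integrable_mult_test(1)[OF i(2) \<psi> b]
      by (simp add: inner_diff_left left_diff_distrib)
    also have "\<dots> = 0"
      using assms(4,5) \<psi> b by (simp add: has_weak_gradient_def)
    finally show "(LINT x|?M. (G x - K x) \<bullet> b * \<psi> x) = 0" .
  qed
  then have "AE x in ?M. \<forall>b\<in>Basis. (G x - K x) \<bullet> b = 0"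
    by (intro AE_finite_allI finite_Basis)
  then show ?thesis
  proof eventually_elim
    case (elim x)
    then show ?case by (simp add: euclidean_eq_iff[of "G x"] inner_diff_left)
  qed
qed

lemma wgrad_W11:
  assumes "u \<in> W11 \<Omega>"
  shows "wgrad \<Omega> u \<in> L1_on \<Omega>" "has_weak_gradient \<Omega> u (wgrad \<Omega> u)"
proof -
  have "\<exists>G. G \<in> L1_on \<Omega> \<and> has_weak_gradient \<Omega> u G"
    using assms by (auto simp: W11_def)
  then show "wgrad \<Omega> u \<in> L1_on \<Omega>" "has_weak_gradient \<Omega> u (wgrad \<Omega> u)"
    unfolding wgrad_def by (metis (mono_tags, lifting) someI_ex)+
qed

text \<open>The choice in \<open>wgrad\<close> is made separately for every \<epsilon>, so the
  exceptional null set depends on \<epsilon>. The identity is therefore always applied at one fixed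
  \<epsilon>.\<close>

lemma wgrad_perturb:
  assumes "open \<Omega>" "u \<in> W11 \<Omega>" "\<phi> \<in> W11 \<Omega>"
  shows "wgrad \<Omega> (perturb u \<phi> \<epsilon>) \<in> L1_on \<Omega>"
    "AE x in lebesgue_on \<Omega>. wgrad \<Omega> (perturb u \<phi> \<epsilon>) x = wgrad \<Omega> u x + \<epsilon> *\<^sub>R wgrad \<Omega> \<phi> x"
proof -
  let ?G = "\<lambda>x. wgrad \<Omega> u x + \<epsilon> *\<^sub>R wgrad \<Omega> \<phi> x"
  have L: "u \<in> L1_on \<Omega>" "\<phi> \<in> L1_on \<Omega>"
    using assms by (auto simp: W11_def)
  have G: "?G \<in> L1_on \<Omega>" and w: "has_weak_gradient \<Omega> (perturb u \<phi> \<epsilon>) ?G"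
    using wgrad_W11[OF assms(2)] wgrad_W11[OF assms(3)] L
    by (auto simp: perturb_def L1_on_def intro!: has_weak_gradient_add_scaled)
  have "perturb u \<phi> \<epsilon> \<in> L1_on \<Omega>"
    using L by (auto simp: perturb_def L1_on_def)
  then have W: "perturb u \<phi> \<epsilon> \<in> W11 \<Omega>"
    using G w by (auto simp: W11_def)
  show "wgrad \<Omega> (perturb u \<phi> \<epsilon>) \<in> L1_on \<Omega>"
    using W by (rule wgrad_W11)
  then show "AE x in lebesgue_on \<Omega>. wgrad \<Omega> (perturb u \<phi> \<epsilon>) x = ?G x"
    using wgrad_W11(2)[OF W] G w by (intro weak_gradient_unique[OF \<open>open \<Omega>\<close>])
qed

subsection \<open>Integrals of norms along a line\<close>

lemma norm_line_has_real_derivative: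
  fixes a p :: "'a::real_inner"
  assumes "a + \<epsilon> *\<^sub>R p = 0 \<Longrightarrow> p = 0"
  shows "((\<lambda>t. norm (a + t *\<^sub>R p)) has_real_derivative
    ((a + \<epsilon> *\<^sub>R p) /\<^sub>R norm (a + \<epsilon> *\<^sub>R p)) \<bullet> p) (at \<epsilon>)"
proof (cases "a + \<epsilon> *\<^sub>R p = 0")
  case True
  \<comment> \<open>Here \<open>p = 0\<close> and \<open>a = 0\<close>: the norm is constantly 0,
    and the formula also gives 0.\<close>
  with assms show ?thesis by simp
next
  case False
  have "((\<lambda>t. a + t *\<^sub>R p) has_derivative (\<lambda>h. h *\<^sub>R p)) (at \<epsilon>)"
    by (auto intro!: derivative_eq_intros)
  from has_derivative_compose[OF this has_derivative_norm[OF False]]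
  show ?thesis
    unfolding has_field_derivative_def
    by (rule has_derivative_eq_rhs) (simp add: fun_eq_iff sgn_div_norm inner_commute)
qed

lemma norm_line_lipschitz:
  fixes a p :: "'a::real_normed_vector"
  shows "\<bar>norm (a + t *\<^sub>R p) - norm (a + s *\<^sub>R p)\<bar> \<le> \<bar>t - s\<bar> * norm p"
proof -
  have "\<bar>norm (a + t *\<^sub>R p) - norm (a + s *\<^sub>R p)\<bar> \<le> norm ((a + t *\<^sub>R p) - (a + s *\<^sub>R p))"
    by (rule norm_triangle_ineq3)
  also have "(a + t *\<^sub>R p) - (a + s *\<^sub>R p) = (t - s) *\<^sub>R p"
    by (simp add: algebra_simps)
  finally show ?thesis by simp
qed

lemma integral_norm_line_lipschitz:
  fixes a p :: "'b \<Rightarrow> 'a::euclidean_space"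
  assumes a: "integrable M a" and p: "integrable M p"
  shows "\<bar>(LINT x|M. norm (a x + t *\<^sub>R p x)) - (LINT x|M. norm (a x + s *\<^sub>R p x))\<bar>
    \<le> \<bar>t - s\<bar> * (LINT x|M. norm (p x))"
proof -
  have i: "integrable M (\<lambda>x. norm (a x + t *\<^sub>R p x))" for t
    using a p by simp
  have "\<bar>(LINT x|M. norm (a x + t *\<^sub>R p x)) - (LINT x|M. norm (a x + s *\<^sub>R p x))\<bar>
      = \<bar>LINT x|M. norm (a x + t *\<^sub>R p x) - norm (a x + s *\<^sub>R p x)\<bar>"
    using i by simp
  also have "\<dots> \<le> (LINT x|M. \<bar>norm (a x + t *\<^sub>R p x) - norm (a x + s *\<^sub>R p x)\<bar>)"
    by (rule integral_abs_bound)
  also have "\<dots> \<le> (LINT x|M. \<bar>t - s\<bar> * norm (p x))"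
    using i p by (intro integral_mono norm_line_lipschitz) auto
  finally show ?thesis by simp
qed

lemma integral_norm_line_has_real_derivative:
  fixes a p :: "'b \<Rightarrow> 'a::euclidean_space"
  assumes a: "integrable M a" and p: "integrable M p"
    and reg: "AE x in M. a x + \<epsilon> *\<^sub>R p x = 0 \<longrightarrow> p x = 0"
  shows "((\<lambda>t. LINT x|M. norm (a x + t *\<^sub>R p x)) has_real_derivative
    (LINT x|M. ((a x + \<epsilon> *\<^sub>R p x) /\<^sub>R norm (a x + \<epsilon> *\<^sub>R p x)) \<bullet> p x)) (at \<epsilon>)"
proof -
  let ?n = "\<lambda>t x. norm (a x + t *\<^sub>R p x)"
  let ?D = "\<lambda>x. ((a x + \<epsilon> *\<^sub>R p x) /\<^sub>R norm (a x + \<epsilon> *\<^sub>R p x)) \<bullet> p x"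
  let ?q = "\<lambda>t x. (?n t x - ?n \<epsilon> x) / (t - \<epsilon>)"
  have [measurable]: "a \<in> borel_measurable M" "p \<in> borel_measurable M"
    using a p by auto
  have i: "integrable M (?n t)" for t
    using a p by simp
  \<comment> \<open>Dominated convergence speaks of sequences, so the limit is tested along
    sequences that tend to \<epsilon> and avoid it. The Lipschitz bound makes
    \<open>norm (p x)\<close> a common majorant of the difference quotients.\<close>
  have "((\<lambda>t. LINT x|M. ?q t x) \<longlongrightarrow> (LINT x|M. ?D x)) (at \<epsilon>)"
    unfolding tendsto_at_iff_sequentially comp_def
  proof (intro allI impI)
    fix X :: "nat \<Rightarrow> real"
    assume X: "\<forall>i. X i \<in> UNIV - {\<epsilon>}" "X \<longlonglongrightarrow> \<epsilon>"
    show "(\<lambda>n. LINT x|M. ?q (X n) x) \<longlonglongrightarrow> (LINT x|M. ?D x)"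
    proof (rule integral_dominated_convergence)
      show "integrable M (\<lambda>x. norm (p x))" using p by simp
      show "AE x in M. (\<lambda>n. ?q (X n) x) \<longlonglongrightarrow> ?D x"
        using reg
      proof eventually_elim
        case (elim x)
        then have "((\<lambda>t. ?q t x) \<longlongrightarrow> ?D x) (at \<epsilon>)"
          using norm_line_has_real_derivative[of "a x" \<epsilon> "p x"] by (simp add: has_field_derivative_iff)
        then show ?case
          using X unfolding tendsto_at_iff_sequentially comp_def by blast
      qed
      show "AE x in M. norm (?q (X n) x) \<le> norm (p x)" for n
        using X(1) norm_line_lipschitz[of "a _" "X n" "p _" \<epsilon>]
        by (intro AE_I2) (simp add: abs_divide pos_divide_le_eq mult.commute)
    qed measurable
  qed
  then show ?thesis
    using i by (simp add: has_field_derivative_iff)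
qed

text \<open>Off the zeros of \<open>p\<close>, only the value \<open>- (a \<bullet> p) / (p \<bullet> p)\<close> of \<open>\<epsilon>\<close> can make \<open>a + \<epsilon> p\<close>
  vanish, so these sets lie in distinct level sets of one function, and the push-forward of a finite
  measure has countably many atoms.\<close>

lemma countable_zero_sets_of_positive_measure:
  fixes a p :: "'b \<Rightarrow> 'a::euclidean_space"
  assumes "finite_measure M"
    and [measurable]: "a \<in> borel_measurable M" "p \<in> borel_measurable M"
  shows "countable {\<epsilon>. \<not> (AE x in M. a x + \<epsilon> *\<^sub>R p x = 0 \<longrightarrow> p x = 0)}"
proof -
  interpret finite_measure M by fact
  define e where "e = (\<lambda>x. - (a x \<bullet> p x) / (p x \<bullet> p x))"
  have [measurable]: "e \<in> borel_measurable M"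
    unfolding e_def by measurable
  interpret d: finite_measure "distr M borel e"
    by (rule finite_measure_distr) measurable
  \<comment> \<open>Points with \<open>p x = 0\<close> have \<open>e x = 0\<close> by the convention
    for division by zero and may add mass to the atom at 0. Hence this is an inclusion, which
    suffices for countability.\<close>
  have "{\<epsilon>. \<not> (AE x in M. a x + \<epsilon> *\<^sub>R p x = 0 \<longrightarrow> p x = 0)} \<subseteq> {\<epsilon>. measure (distr M borel e) {\<epsilon>} \<noteq> 0}"
  proof (rule Collect_mono, rule impI, rule notI)
    fix \<epsilon>
    assume n: "\<not> (AE x in M. a x + \<epsilon> *\<^sub>R p x = 0 \<longrightarrow> p x = 0)"
      and "measure (distr M borel e) {\<epsilon>} = 0"
    then have "emeasure M (e -` {\<epsilon>} \<inter> space M) = 0"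
      by (simp add: measure_distr emeasure_eq_measure)
    then have "e -` {\<epsilon>} \<inter> space M \<in> null_sets M"
      by (auto intro!: null_setsI)
    then have "AE x in M. x \<notin> e -` {\<epsilon>} \<inter> space M"
      by (rule AE_not_in)
    then have "AE x in M. a x + \<epsilon> *\<^sub>R p x = 0 \<longrightarrow> p x = 0"
      using AE_space
    proof eventually_elim
      case (elim x)
      show ?case
      proof (intro impI, rule ccontr)
        assume z: "a x + \<epsilon> *\<^sub>R p x = 0" and "p x \<noteq> 0"
        have "a x = - (\<epsilon> *\<^sub>R p x)"
          using z by (simp add: add_eq_0_iff2)
        with \<open>p x \<noteq> 0\<close> have "e x = \<epsilon>"
          by (simp add: e_def)
        with elim show False by simp
      qed
    qed
    with n show False by contradiction
  qed
  then show ?thesis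
    using d.countable_support by (rule countable_subset)
qed

subsection \<open>The functional along a line\<close>

lemma Linfty_mult_L1_integrable:
  fixes H f :: "'a::euclidean_space \<Rightarrow> real"
  assumes "H \<in> Linfty_on \<Omega>" "f \<in> L1_on \<Omega>"
  shows "integrable (lebesgue_on \<Omega>) (\<lambda>x. H x * f x)"
  using assms by (auto simp: Linfty_on_def L1_on_def intro: integrable_mult_bounded)

text \<open>The gradient of the perturbation occurs only under the integral, so the almost
  everywhere identity becomes an equation valid for every \<epsilon>, in terms of functions that do
  not vary with \<epsilon>.\<close>

lemma functional_perturb:
  assumes "open \<Omega>" "F \<in> L1_on \<Omega>" "H \<in> Linfty_on \<Omega>" "u \<in> W11 \<Omega>" "\<phi> \<in> W11 \<Omega>"
  shows "functional \<Omega> F H (perturb u \<phi> \<epsilon>)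
    = (LINT x|lebesgue_on \<Omega>. norm ((wgrad \<Omega> u x + F x) + \<epsilon> *\<^sub>R wgrad \<Omega> \<phi> x))
      + (LINT x|lebesgue_on \<Omega>. H x * u x) + \<epsilon> * (LINT x|lebesgue_on \<Omega>. H x * \<phi> x)"
proof -
  let ?M = "lebesgue_on \<Omega>"
  let ?v = "perturb u \<phi> \<epsilon>"
  have uv: "u \<in> L1_on \<Omega>" "\<phi> \<in> L1_on \<Omega>"
    using assms by (auto simp: W11_def)
  have Hi: "integrable ?M (\<lambda>x. H x * u x)" "integrable ?M (\<lambda>x. H x * \<phi> x)"
    using assms(3) uv by (auto intro: Linfty_mult_L1_integrable)
  have i: "integrable ?M (\<lambda>x. norm ((wgrad \<Omega> u x + F x) + \<epsilon> *\<^sub>R wgrad \<Omega> \<phi> x))"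
    using wgrad_W11(1)[OF assms(4)] wgrad_W11(1)[OF assms(5)] assms(2) by (simp add: L1_on_def)
  have [measurable]: "wgrad \<Omega> u \<in> borel_measurable ?M" "wgrad \<Omega> \<phi> \<in> borel_measurable ?M"
    "wgrad \<Omega> ?v \<in> borel_measurable ?M" "F \<in> borel_measurable ?M" "H \<in> borel_measurable ?M"
    "u \<in> borel_measurable ?M" "\<phi> \<in> borel_measurable ?M"
    using wgrad_W11(1)[OF assms(4)] wgrad_W11(1)[OF assms(5)] wgrad_perturb(1)[OF assms(1,4,5)]
      assms(2,3) uv by (auto simp: L1_on_def Linfty_on_def)
  have [measurable]: "?v \<in> borel_measurable ?M"
    unfolding perturb_def by measurable
  have "functional \<Omega> F H ?v = (LINT x|?M. norm ((wgrad \<Omega> u x + F x) + \<epsilon> *\<^sub>R wgrad \<Omega> \<phi> x)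
      + (H x * u x + \<epsilon> * (H x * \<phi> x)))"
    unfolding functional_def
  proof (rule integral_cong_AE)
    show "AE x in ?M. norm (wgrad \<Omega> ?v x + F x) + H x * ?v x
        = norm ((wgrad \<Omega> u x + F x) + \<epsilon> *\<^sub>R wgrad \<Omega> \<phi> x) + (H x * u x + \<epsilon> * (H x * \<phi> x))"
      using wgrad_perturb(2)[OF assms(1,4,5), of \<epsilon>]
      by eventually_elim (simp add: perturb_def algebra_simps)
  qed measurable
  also have "\<dots> = (LINT x|?M. norm ((wgrad \<Omega> u x + F x) + \<epsilon> *\<^sub>R wgrad \<Omega> \<phi> x))
      + (LINT x|?M. H x * u x + \<epsilon> * (H x * \<phi> x))"
    by (rule Bochner_Integration.integral_add[OF i]) (use Hi in simp)
  also have "(LINT x|?M. H x * u x + \<epsilon> * (H x * \<phi> x))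
      = (LINT x|?M. H x * u x) + \<epsilon> * (LINT x|?M. H x * \<phi> x)"
    using Hi by (subst Bochner_Integration.integral_add) auto
  finally show ?thesis by simp
qed

text \<open>This allows passing between \<open>lebesgue\<close> and its restrictions to the singular
  set and to the complement of that set in \<Omega>.\<close>

lemma measurable_sing_set:
  assumes "open \<Omega>" "F \<in> L1_on \<Omega>" "wgrad \<Omega> v \<in> L1_on \<Omega>"
  shows "sing_set \<Omega> F v \<in> sets lebesgue"
proof -
  have [measurable]: "F \<in> borel_measurable (lebesgue_on \<Omega>)" "wgrad \<Omega> v \<in> borel_measurable (lebesgue_on \<Omega>)"
    using assms by (auto simp: L1_on_def)
  have "{x \<in> space (lebesgue_on \<Omega>). wgrad \<Omega> v x + F x = 0} \<in> sets (lebesgue_on \<Omega>)"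
    by measurable
  then show ?thesis
    using assms(1) by (simp add: sing_set_def space_restrict_space sets_restrict_space_iff)
qed

text \<open>\<open>kappa\<close> involves a gradient chosen anew for each \<epsilon>. Expressing
  regularity through two fixed functions makes the exceptional sets of different \<epsilon>
  comparable, as the counting argument demands.\<close>

lemma regular_eps_iff:
  assumes "open \<Omega>" "F \<in> L1_on \<Omega>" "u \<in> W11 \<Omega>" "\<phi> \<in> W11 \<Omega>"
  shows "regular_eps \<Omega> F u \<phi> \<epsilon> \<longleftrightarrow>
    (AE x in lebesgue_on \<Omega>. (wgrad \<Omega> u x + F x) + \<epsilon> *\<^sub>R wgrad \<Omega> \<phi> x = 0 \<longrightarrow> wgrad \<Omega> \<phi> x = 0)"
proof -
  let ?M = "lebesgue_on \<Omega>"
  let ?w = "wgrad \<Omega> (perturb u \<phi> \<epsilon>)"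
  have [measurable]: "F \<in> borel_measurable ?M" "?w \<in> borel_measurable ?M" "wgrad \<Omega> \<phi> \<in> borel_measurable ?M"
    using assms(2) wgrad_W11(1)[OF assms(4)] wgrad_perturb(1)[OF assms(1,3,4)] by (auto simp: L1_on_def)
  let ?N = "{x \<in> space ?M. \<not> (?w x + F x = 0 \<longrightarrow> wgrad \<Omega> \<phi> x = 0)}"
  have N: "?N \<in> sets ?M" by measurable
  have "?N = sing_set \<Omega> F (perturb u \<phi> \<epsilon>) \<inter> {x \<in> \<Omega>. wgrad \<Omega> \<phi> x \<noteq> 0}"
    by (auto simp: sing_set_def)
  moreover have "emeasure ?M ?N = emeasure lebesgue ?N"
    using assms(1) by (intro emeasure_restrict_space) auto
  ultimately have "regular_eps \<Omega> F u \<phi> \<epsilon> \<longleftrightarrow> emeasure ?M ?N = 0"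
    by (simp add: regular_eps_def kappa_def)
  also have "\<dots> \<longleftrightarrow> (AE x in ?M. ?w x + F x = 0 \<longrightarrow> wgrad \<Omega> \<phi> x = 0)"
    by (rule AE_iff_measurable[OF N refl, symmetric])
  also have "\<dots> \<longleftrightarrow>
      (AE x in ?M. (wgrad \<Omega> u x + F x) + \<epsilon> *\<^sub>R wgrad \<Omega> \<phi> x = 0 \<longrightarrow> wgrad \<Omega> \<phi> x = 0)"
    by (rule eventually_cong[OF wgrad_perturb(2)[OF assms(1,3,4), of \<epsilon>]]) (simp add: algebra_simps)
  finally show ?thesis .
qed

theorem lemma3p1:
  fixes \<Omega> :: "(real ^ 'm) set" and F :: "real ^ 'm \<Rightarrow> real ^ 'm"
    and H u \<phi> :: "real ^ 'm \<Rightarrow> real"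
  assumes "open \<Omega>" and "connected \<Omega>" and "\<Omega> \<noteq> {}" and "bounded \<Omega>"
    and "F \<in> L1_on \<Omega>" and "H \<in> Linfty_on \<Omega>"
    and "u \<in> W11 \<Omega>" and "\<phi> \<in> W11 \<Omega>"
  shows "(\<exists>L. L-lipschitz_on UNIV (\<lambda>\<epsilon>. functional \<Omega> F H (perturb u \<phi> \<epsilon>)))
    \<and> countable {\<epsilon>. singular_eps \<Omega> F u \<phi> \<epsilon>}
    \<and> (\<forall>\<epsilon>. regular_eps \<Omega> F u \<phi> \<epsilon> \<longrightarrow>
         (LINT x|lebesgue_on (sing_set \<Omega> F (perturb u \<phi> \<epsilon>)). norm (wgrad \<Omega> \<phi> x)) = 0
       \<and> ((\<lambda>t. functional \<Omega> F H (perturb u \<phi> t)) has_real_derivative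
           (LINT x|lebesgue_on (\<Omega> - sing_set \<Omega> F (perturb u \<phi> \<epsilon>)).
               N_field \<Omega> F (perturb u \<phi> \<epsilon>) x \<bullet> wgrad \<Omega> \<phi> x)
           + (LINT x|lebesgue_on \<Omega>. H x * \<phi> x)) (at \<epsilon>))"
proof (intro conjI allI impI)
  let ?M = "lebesgue_on \<Omega>"
  define a where "a = (\<lambda>x. wgrad \<Omega> u x + F x)"
  define p where "p = wgrad \<Omega> \<phi>"
  define h where "h = (LINT x|?M. H x * \<phi> x)"
  have a: "integrable ?M a" and p: "integrable ?M p"
    using wgrad_W11(1)[OF assms(7)] wgrad_W11(1)[OF assms(8)] assms(5)
    by (auto simp: L1_on_def a_def p_def)
  have fn: "functional \<Omega> F H (perturb u \<phi> t)
      = (LINT x|?M. norm (a x + t *\<^sub>R p x)) + (LINT x|?M. H x * u x) + t * h" for t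
    using functional_perturb[OF assms(1,5-8)] by (simp add: a_def p_def h_def)
  have reg: "regular_eps \<Omega> F u \<phi> \<epsilon> \<longleftrightarrow> (AE x in ?M. a x + \<epsilon> *\<^sub>R p x = 0 \<longrightarrow> p x = 0)" for \<epsilon>
    using regular_eps_iff[OF assms(1,5,7,8)] by (simp add: a_def p_def)

  \<comment> \<open>The first summand bounds the variation of the norm integral, the second is the
    absolute slope of the affine part.\<close>
  let ?L = "(LINT x|?M. norm (p x)) + \<bar>h\<bar>"
  have "?L-lipschitz_on UNIV (\<lambda>\<epsilon>. functional \<Omega> F H (perturb u \<phi> \<epsilon>))"
  proof (rule lipschitz_onI)
    fix t s :: real
    have "\<bar>functional \<Omega> F H (perturb u \<phi> t) - functional \<Omega> F H (perturb u \<phi> s)\<bar>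
        = \<bar>((LINT x|?M. norm (a x + t *\<^sub>R p x)) - (LINT x|?M. norm (a x + s *\<^sub>R p x))) + (t - s) * h\<bar>"
      by (simp add: fn algebra_simps)
    also have "\<dots> \<le> \<bar>t - s\<bar> * (LINT x|?M. norm (p x)) + \<bar>t - s\<bar> * \<bar>h\<bar>"
      using integral_norm_line_lipschitz[OF a p, of t s]
      by (intro order_trans[OF abs_triangle_ineq] add_mono) (auto simp: abs_mult)
    finally show "dist (functional \<Omega> F H (perturb u \<phi> t)) (functional \<Omega> F H (perturb u \<phi> s))
        \<le> ?L * dist t s"
      by (simp add: dist_real_def algebra_simps)
  qed simp
  then show "\<exists>L. L-lipschitz_on UNIV (\<lambda>\<epsilon>. functional \<Omega> F H (perturb u \<phi> \<epsilon>))" ..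

  \<comment> \<open>Boundedness of \<Omega> enters here, through the finiteness of its
    measure.\<close>
  have "finite_measure ?M"
    using assms(1,4) by (intro finite_measure_lebesgue_on bounded_set_imp_lmeasurable) auto
  then have "countable {\<epsilon>. \<not> (AE x in ?M. a x + \<epsilon> *\<^sub>R p x = 0 \<longrightarrow> p x = 0)}"
    using a p by (intro countable_zero_sets_of_positive_measure) auto
  also have "{\<epsilon>. \<not> (AE x in ?M. a x + \<epsilon> *\<^sub>R p x = 0 \<longrightarrow> p x = 0)} = {\<epsilon>. singular_eps \<Omega> F u \<phi> \<epsilon>}"
    by (simp add: reg[symmetric] singular_eps_def regular_eps_def zero_less_iff_neq_zero)
  finally show "countable {\<epsilon>. singular_eps \<Omega> F u \<phi> \<epsilon>}" .

  fix \<epsilon> assume r: "regular_eps \<Omega> F u \<phi> \<epsilon>"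
  let ?v = "perturb u \<phi> \<epsilon>"
  let ?S = "sing_set \<Omega> F ?v"
  have \<Omega>: "\<Omega> \<in> sets lebesgue"
    using assms(1) by simp
  have S: "?S \<in> sets lebesgue" and S\<Omega>: "?S \<subseteq> \<Omega>"
    using measurable_sing_set[OF assms(1,5) wgrad_perturb(1)[OF assms(1,7,8)]]
    by (auto simp: sing_set_def)
  have w: "AE x in ?M. wgrad \<Omega> ?v x + F x = a x + \<epsilon> *\<^sub>R p x"
    using wgrad_perturb(2)[OF assms(1,7,8), of \<epsilon>] by eventually_elim (simp add: a_def p_def)
  \<comment> \<open>On the singular set \<open>a + \<epsilon> p\<close> vanishes almost everywhere,
    and regularity then forces \<open>p = 0\<close>.\<close>
  have "AE x in ?M. x \<in> ?S \<longrightarrow> p x = 0"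
    using w r[unfolded reg] by eventually_elim (auto simp: sing_set_def)
  then have "AE x in lebesgue. x \<in> ?S \<longrightarrow> p x = 0"
    using \<Omega> S\<Omega> by (auto simp: AE_restrict_space_iff elim: eventually_mono)
  then show "(LINT x|lebesgue_on ?S. norm (wgrad \<Omega> \<phi> x)) = 0"
    using S by (intro integral_eq_zero_AE) (simp add: AE_restrict_space_iff p_def)

  have [measurable]: "F \<in> borel_measurable ?M" "wgrad \<Omega> ?v \<in> borel_measurable ?M"
      "p \<in> borel_measurable ?M" "a \<in> borel_measurable ?M"
    using assms(5) wgrad_perturb(1)[OF assms(1,7,8)] a p by (auto simp: L1_on_def)
  have "(LINT x|lebesgue_on (\<Omega> - ?S). N_field \<Omega> F ?v x \<bullet> p x) = (LINT x|?M. N_field \<Omega> F ?v x \<bullet> p x)"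
  proof -
    have "(LINT x|lebesgue_on (\<Omega> - ?S). N_field \<Omega> F ?v x \<bullet> p x)
        = (LINT x|lebesgue. indicator (\<Omega> - ?S) x *\<^sub>R (N_field \<Omega> F ?v x \<bullet> p x))"
      using S \<Omega> by (intro integral_restrict_space) auto
    \<comment> \<open>On the singular set the numerator of \<open>N_field\<close> is 0, so the field
      takes the value 0 there and this set can be added back to the domain of integration.\<close>
    also have "\<dots> = (LINT x|lebesgue. indicator \<Omega> x *\<^sub>R (N_field \<Omega> F ?v x \<bullet> p x))"
      by (intro Bochner_Integration.integral_cong refl)
        (auto simp: indicator_def N_field_def sing_set_def)
    also have "\<dots> = (LINT x|?M. N_field \<Omega> F ?v x \<bullet> p x)"
      using \<Omega> by (intro integral_restrict_space[symmetric]) auto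
    finally show ?thesis .
  qed
  also have "\<dots> = (LINT x|?M. ((a x + \<epsilon> *\<^sub>R p x) /\<^sub>R norm (a x + \<epsilon> *\<^sub>R p x)) \<bullet> p x)"
  proof (rule integral_cong_AE)
    show "AE x in ?M. N_field \<Omega> F ?v x \<bullet> p x = ((a x + \<epsilon> *\<^sub>R p x) /\<^sub>R norm (a x + \<epsilon> *\<^sub>R p x)) \<bullet> p x"
      using w by eventually_elim (simp add: N_field_def)
  qed (unfold N_field_def, measurable)
  finally have D: "((\<lambda>t. LINT x|?M. norm (a x + t *\<^sub>R p x)) has_real_derivative
      (LINT x|lebesgue_on (\<Omega> - ?S). N_field \<Omega> F ?v x \<bullet> p x)) (at \<epsilon>)"
    using integral_norm_line_has_real_derivative[OF a p r[unfolded reg]] by simp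
  show "((\<lambda>t. functional \<Omega> F H (perturb u \<phi> t)) has_real_derivative
      (LINT x|lebesgue_on (\<Omega> - ?S). N_field \<Omega> F ?v x \<bullet> wgrad \<Omega> \<phi> x)
      + (LINT x|?M. H x * \<phi> x)) (at \<epsilon>)"
    unfolding fn p_def[symmetric] h_def[symmetric]
    by (rule derivative_eq_intros D refl | simp)+
qed

end
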